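(* Let $E$ be a Dedekind complete real Banach lattice. For $T\in\mathcal Z(E_{\mathbb C})$, its order unit norm $\lVert T\rVert_I$, its regular norm $\lVert T\rVert_r$, and its norm $\lVert T\rVert_{E_{\mathbb C}}$ as a bounded operator on $E_{\mathbb C}$ are equal.
   Context: Operators are linear; $I$ denotes the identity operator. For a Dedekind complete real Banach lattice $E$, the complexification $E_{\mathbb C}=E+iE$ carries the modulus $|x+iy|=\sup_{\theta\in[0,2\pi]}(x\cos\theta+y\sin\theta)$ and the norm $\lVert z\rVert=\lVert\,|z|\,\rVert$. $L_r(E)$ is the Dedekind complete vector lattice of regular operators on $E$ (differences of positive operators). $L_r(E_{\mathbb C})=L_r(E)+iL_r(E)$ is its complexification, acting on $E_{\mathbb C}$ in the obvious way; for $T=R+iS$ with $R,S\in L_r(E)$, $|T|=\sup_\theta(R\cos\theta+S\sin\theta)\in L_r(E)$. The regular norm of $T\in L_r(E_{\mathbb C})$ is $\lVert T\rVert_r=\lVert\,|T|\,\rVert$, the operator norm of its modulus. The centre of $E_{\mathbb C}$ is $\mathcal Z(E_{\mathbb C})=\{T\in L_r(E_{\mathbb C}): |T|\le\lambda I\text{ for some }\lambda\ge0\}$, with order unit norm $\lVert T\rVert_I=\inf\{\lambda\ge0:|T|\le\lambda I\}$. *)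

theory Defs
  imports "HOL-Analysis.Analysis" "HOL-Library.Lattice_Algebras"
begin

section \<open>Dedekind complete Banach lattices\<close>

class dedekind_complete_vector_lattice =
  ordered_real_vector + lattice_ab_group_add + conditionally_complete_lattice

class dedekind_complete_banach_lattice =
  banach + dedekind_complete_vector_lattice + lattice_ab_group_add_abs +
  assumes norm_mono_abs: "\<bar>x\<bar> \<le> \<bar>y\<bar> \<Longrightarrow> norm x \<le> norm y"


section \<open>Regular operators\<close>

definition positive_operator ::
    "('a::ordered_real_vector \<Rightarrow> 'a) \<Rightarrow> bool" where
  "positive_operator T \<longleftrightarrow> linear T \<and> (\<forall>x\<ge>0. 0 \<le> T x)"

lemma positive_operator_0: "positive_operator (\<lambda>x. 0)"
  by (auto simp: positive_operator_def linear_iff)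

lemma positive_operator_id: "positive_operator (\<lambda>x. x)"
  by (auto simp: positive_operator_def linear_iff)

lemma positive_operator_add:
  "positive_operator P \<Longrightarrow> positive_operator Q \<Longrightarrow> positive_operator (\<lambda>x. P x + Q x)"
  by (auto simp: positive_operator_def linear_iff algebra_simps)

lemma positive_operator_scaleR:
  "positive_operator P \<Longrightarrow> 0 \<le> c \<Longrightarrow> positive_operator (\<lambda>x. c *\<^sub>R P x)"
  by (auto simp: positive_operator_def linear_iff algebra_simps scaleR_nonneg_nonneg)

typedef (overloaded) 'a regop =
  "{T :: 'a::ordered_real_vector \<Rightarrow> 'a.
     \<exists>P Q. positive_operator P \<and> positive_operator Q \<and> T = (\<lambda>x. P x - Q x)}"
  morphisms regop_apply Regop
  using positive_operator_0 by auto

setup_lifting type_definition_regop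

lemma regop_linear: "linear (regop_apply T)"
  using regop_apply[of T] by (auto simp: positive_operator_def linear_iff algebra_simps)

lemma regop_cases:
  obtains P Q where "positive_operator P" "positive_operator Q"
    "\<And>x. regop_apply T x = P x - Q x"
proof -
  from regop_apply[of T] show ?thesis by (auto intro: that dest: fun_cong)
qed

instantiation regop :: (ordered_real_vector) real_vector
begin

lift_definition zero_regop :: "'a regop" is "\<lambda>x. 0"
  using positive_operator_0 by force

lift_definition plus_regop :: "'a regop \<Rightarrow> 'a regop \<Rightarrow> 'a regop" is "\<lambda>S T x. S x + T x"
proof -
  fix S T :: "'a \<Rightarrow> 'a"
  assume "\<exists>P Q. positive_operator P \<and> positive_operator Q \<and> S = (\<lambda>x. P x - Q x)"
    and "\<exists>P Q. positive_operator P \<and> positive_operator Q \<and> T = (\<lambda>x. P x - Q x)"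
  then obtain P Q P' Q' where
    "positive_operator P" "positive_operator Q" "S = (\<lambda>x. P x - Q x)"
    "positive_operator P'" "positive_operator Q'" "T = (\<lambda>x. P' x - Q' x)" by blast
  then show "\<exists>P Q. positive_operator P \<and> positive_operator Q \<and> (\<lambda>x. S x + T x) = (\<lambda>x. P x - Q x)"
    by (intro exI[of _ "\<lambda>x. P x + P' x"] exI[of _ "\<lambda>x. Q x + Q' x"])
       (auto intro: positive_operator_add)
qed

lift_definition uminus_regop :: "'a regop \<Rightarrow> 'a regop" is "\<lambda>T x. - T x"
  by (metis minus_diff_eq)

definition minus_regop :: "'a regop \<Rightarrow> 'a regop \<Rightarrow> 'a regop" where
  "S - T = S + (- T)" for S T :: "'a regop"

lift_definition scaleR_regop :: "real \<Rightarrow> 'a regop \<Rightarrow> 'a regop" is "\<lambda>c T x. c *\<^sub>R T x"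
proof -
  fix c :: real and T :: "'a \<Rightarrow> 'a"
  assume "\<exists>P Q. positive_operator P \<and> positive_operator Q \<and> T = (\<lambda>x. P x - Q x)"
  then obtain P Q where
    PQ: "positive_operator P" "positive_operator Q" "T = (\<lambda>x. P x - Q x)" by blast
  show "\<exists>P Q. positive_operator P \<and> positive_operator Q \<and> (\<lambda>x. c *\<^sub>R T x) = (\<lambda>x. P x - Q x)"
  proof (cases "0 \<le> c")
    case True
    with PQ show ?thesis
      by (intro exI[of _ "\<lambda>x. c *\<^sub>R P x"] exI[of _ "\<lambda>x. c *\<^sub>R Q x"])
         (auto intro: positive_operator_scaleR simp: algebra_simps)
  next
    case False
    with PQ show ?thesis
      by (intro exI[of _ "\<lambda>x. (-c) *\<^sub>R Q x"] exI[of _ "\<lambda>x. (-c) *\<^sub>R P x"])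
         (auto intro: positive_operator_scaleR[where c = "-c", simplified] simp: algebra_simps)
  qed
qed

instance
  by standard (simp add: minus_regop_def | transfer, simp add: algebra_simps)+

end

lift_definition id_regop :: "'a::ordered_real_vector regop" is "\<lambda>x. x"
  by (intro exI[of _ "\<lambda>x. x"] exI[of _ "\<lambda>x. 0"])
     (auto intro: positive_operator_id positive_operator_0)

lemma minus_regop_apply: "regop_apply (S - T) x = regop_apply S x - regop_apply T x"
  unfolding minus_regop_def by transfer simp

text \<open>The order is \<open>S \<le> T \<longleftrightarrow> T - S\<close> positive; on an arbitrary ordered vector space this is only
  antisymmetric if the cone is generating, hence the sort in the following instance.\<close>

lemma pprt_minus: "x = pprt x - pprt (- x)" for x :: "'a::lattice_ab_group_add"
  by (simp add: pprt_neg flip: prts)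

lemma regop_eqI:
  fixes S T :: "'a::dedekind_complete_vector_lattice regop"
  assumes "\<And>x. 0 \<le> x \<Longrightarrow> regop_apply S x = regop_apply T x"
  shows "S = T"
proof -
  have "regop_apply S x = regop_apply T x" for x
    using assms[of "pprt x"] assms[of "pprt (-x)"]
      linear_diff[OF regop_linear, of S "pprt x" "pprt (-x)"]
      linear_diff[OF regop_linear, of T "pprt x" "pprt (-x)"]
    by (simp flip: pprt_minus)
  then show ?thesis by (simp add: regop_apply_inject[symmetric] fun_eq_iff)
qed

instantiation regop :: (dedekind_complete_vector_lattice) ordered_real_vector
begin

definition less_eq_regop :: "'a regop \<Rightarrow> 'a regop \<Rightarrow> bool" where
  "S \<le> T \<longleftrightarrow> (\<forall>x\<ge>0. regop_apply S x \<le> regop_apply T x)" for S T :: "'a regop"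

definition less_regop :: "'a regop \<Rightarrow> 'a regop \<Rightarrow> bool" where
  "S < T \<longleftrightarrow> S \<le> T \<and> \<not> T \<le> S" for S T :: "'a regop"

instance
proof
  fix S T U :: "'a regop" and a b :: real
  show "S < T \<longleftrightarrow> S \<le> T \<and> \<not> T \<le> S" by (rule less_regop_def)
  show "S \<le> S" by (simp add: less_eq_regop_def)
  show "S \<le> T \<Longrightarrow> T \<le> U \<Longrightarrow> S \<le> U" by (meson less_eq_regop_def order_trans)
  show "S \<le> T \<Longrightarrow> T \<le> S \<Longrightarrow> S = T" by (rule regop_eqI) (simp add: less_eq_regop_def antisym)
  show "S \<le> T \<Longrightarrow> U + S \<le> U + T" by (simp add: less_eq_regop_def plus_regop.rep_eq)
  show "S \<le> T \<Longrightarrow> 0 \<le> a \<Longrightarrow> a *\<^sub>R S \<le> a *\<^sub>R T"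
    by (simp add: less_eq_regop_def scaleR_regop.rep_eq scaleR_left_mono)
  show "a \<le> b \<Longrightarrow> 0 \<le> S \<Longrightarrow> a *\<^sub>R S \<le> b *\<^sub>R S"
    by (simp add: less_eq_regop_def scaleR_regop.rep_eq zero_regop.rep_eq scaleR_right_mono)
qed

end


subsection \<open>Regular operators form a Dedekind complete vector lattice\<close>

lemma linear_extension_from_cone:
  fixes f :: "'a::dedekind_complete_vector_lattice \<Rightarrow> 'a"
  assumes add: "\<And>x y. 0 \<le> x \<Longrightarrow> 0 \<le> y \<Longrightarrow> f (x + y) = f x + f y"
    and scale: "\<And>c x. 0 < c \<Longrightarrow> 0 \<le> x \<Longrightarrow> f (c *\<^sub>R x) = c *\<^sub>R f x"
  obtains F where "linear F" "\<And>x. 0 \<le> x \<Longrightarrow> F x = f x"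
proof
  define F where "F x = f (pprt x) - f (pprt (- x))" for x
  have f0: "f 0 = 0" using add[of 0 0] by simp
  have F: "F x = f a - f b" if "0 \<le> a" "0 \<le> b" "x = a - b" for x a b
  proof -
    have "a - b + (b + pprt (- x)) = pprt x - pprt (- x) + (b + pprt (- x))"
      using that(3) pprt_minus[of x] by simp
    then have "pprt x + b = a + pprt (- x)" by (simp add: algebra_simps)
    then have "f (pprt x) + f b = f a + f (pprt (- x))"
      using that by (metis add zero_le_pprt)
    then show ?thesis by (simp add: F_def algebra_simps)
  qed
  show "F x = f x" if "0 \<le> x" for x using F[of x 0 x] that by (simp add: f0)
  show "linear F"
  proof (rule linearI)
    fix x y
    have "F (x + y) = f (pprt x + pprt y) - f (pprt (- x) + pprt (- y))"
    proof (rule F)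
      have "x + y = (pprt x - pprt (- x)) + (pprt y - pprt (- y))"
        by (simp flip: pprt_minus)
      then show "x + y = pprt x + pprt y - (pprt (- x) + pprt (- y))" by (simp add: algebra_simps)
    qed (simp_all add: add_nonneg_nonneg)
    also have "\<dots> = F x + F y" by (simp add: F_def add)
    finally show "F (x + y) = F x + F y" .
  next
    fix c :: real and x
    consider "c > 0" | "c = 0" | "c < 0" by linarith
    then show "F (c *\<^sub>R x) = c *\<^sub>R F x"
    proof cases
      case 1
      have "F (c *\<^sub>R x) = f (c *\<^sub>R pprt x) - f (c *\<^sub>R pprt (- x))"
      proof (rule F)
        show "c *\<^sub>R x = c *\<^sub>R pprt x - c *\<^sub>R pprt (- x)"
          by (subst pprt_minus[of x]) (rule scaleR_diff_right)
      qed (use 1 in \<open>simp_all add: scaleR_nonneg_nonneg\<close>)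
      then show ?thesis using 1 by (simp add: F_def scale algebra_simps)
    next
      case 2
      then show ?thesis using F[of 0 0 0] by simp
    next
      case 3
      have "F (c *\<^sub>R x) = f ((- c) *\<^sub>R pprt (- x)) - f ((- c) *\<^sub>R pprt x)"
      proof (rule F)
        have "c *\<^sub>R x = c *\<^sub>R (pprt x - pprt (- x))" by (simp flip: pprt_minus)
        then show "c *\<^sub>R x = (- c) *\<^sub>R pprt (- x) - (- c) *\<^sub>R pprt x" by (simp add: algebra_simps)
        show "0 \<le> (- c) *\<^sub>R pprt (- x)" "0 \<le> (- c) *\<^sub>R pprt x"
          using 3 by (intro scaleR_nonneg_nonneg; simp)+
      qed
      also have "\<dots> = (- c) *\<^sub>R f (pprt (- x)) - (- c) *\<^sub>R f (pprt x)"
        using 3 by (simp only: scale zero_le_pprt neg_0_less_iff_less)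
      finally show ?thesis by (simp add: F_def algebra_simps)
    qed
  qed
qed

text \<open>Riesz--Kantorovich: on \<open>x \<ge> 0\<close> the supremum of a bounded set \<open>A\<close> of operators is
  \<open>sup {T\<^sub>1 y\<^sub>1 + \<dots> + T\<^sub>n y\<^sub>n | T\<^sub>i \<in> A, y\<^sub>i \<ge> 0, y\<^sub>1 + \<dots> + y\<^sub>n = x}\<close>.
  Decompositions are lists of pairs \<open>(T\<^sub>i, y\<^sub>i)\<close>.\<close>

definition decomps ::
    "'a::dedekind_complete_vector_lattice regop set \<Rightarrow> 'a \<Rightarrow> ('a regop \<times> 'a) list set" where
  "decomps A x = {l. set l \<subseteq> A \<times> {0..} \<and> sum_list (map snd l) = x}"

definition decomp_val :: "('a::dedekind_complete_vector_lattice regop \<times> 'a) list \<Rightarrow> 'a" where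
  "decomp_val l = sum_list (map (\<lambda>(T, y). regop_apply T y) l)"

lemma decomps_split:
  assumes "l \<in> decomps A (x + y)" "0 \<le> x" "0 \<le> y"
  shows "\<exists>l1 \<in> decomps A x. \<exists>l2 \<in> decomps A y. decomp_val l = decomp_val l1 + decomp_val l2"
  using assms
proof (induction l arbitrary: x y)
  case Nil
  then have "x + y = 0" by (simp add: decomps_def)
  with Nil have "x = 0" "y = 0" by (auto simp: add_nonneg_eq_0_iff)
  then show ?case by (intro bexI[of _ "[]"]) (auto simp: decomps_def decomp_val_def)
next
  case (Cons p l)
  obtain T z where p: "p = (T, z)" by force
  define s where "s = sum_list (map snd l)"
  define z1 where "z1 = inf z x"
  have T: "T \<in> A" "0 \<le> z" and l: "set l \<subseteq> A \<times> {0..}" and sum: "z + s = x + y"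
    using Cons.prems(1) by (auto simp: decomps_def p s_def)
  have s: "0 \<le> s" unfolding s_def using l by (intro sum_list_nonneg) auto
  have z1: "0 \<le> z1" "z1 \<le> x" "z1 \<le> z" using T Cons.prems by (auto simp: z1_def)
  have "z - z1 = sup (z - z) (z - x)" unfolding z1_def
    by (simp add: diff_inf_eq_sup add_sup_distrib_left)
  also have "\<dots> \<le> y"
  proof (rule le_supI)
    show "z - z \<le> y" using Cons.prems by simp
    have "z - x = y - s" using sum by (simp add: algebra_simps)
    then show "z - x \<le> y" using s by simp
  qed
  finally have z2: "z - z1 \<le> y" .
  have "s = (x - z1) + (y - (z - z1))" using sum by (simp add: algebra_simps)
  then have "l \<in> decomps A ((x - z1) + (y - (z - z1)))" using l by (simp add: decomps_def s_def)
  from Cons.IH[OF this] z1 z2 obtain l1 l2 where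
    l12: "l1 \<in> decomps A (x - z1)" "l2 \<in> decomps A (y - (z - z1))"
      "decomp_val l = decomp_val l1 + decomp_val l2" by auto
  show ?case
  proof (intro bexI)
    show "(T, z1) # l1 \<in> decomps A x" "(T, z - z1) # l2 \<in> decomps A y"
      using l12 T z1 by (auto simp: decomps_def)
    show "decomp_val (p # l) = decomp_val ((T, z1) # l1) + decomp_val ((T, z - z1) # l2)"
      using l12 by (simp add: decomp_val_def p linear_diff[OF regop_linear])
  qed
qed

lemma decomps_append:
  "l \<in> decomps A x \<Longrightarrow> m \<in> decomps A y \<Longrightarrow> l @ m \<in> decomps A (x + y)"
  by (auto simp: decomps_def)

lemma decomp_val_append: "decomp_val (l @ m) = decomp_val l + decomp_val m"
  by (simp add: decomp_val_def)

lemma decomps_scale: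
  assumes "l \<in> decomps A x" "0 \<le> c"
  shows "map (map_prod id (scaleR c)) l \<in> decomps A (c *\<^sub>R x)"
proof -
  have "sum_list (map snd (map (map_prod id (scaleR c)) l)) = c *\<^sub>R sum_list (map snd l)"
    by (induction l) (auto simp: algebra_simps)
  with assms show ?thesis by (auto simp: decomps_def intro!: scaleR_nonneg_nonneg)
qed

lemma decomp_val_scale: "decomp_val (map (map_prod id (scaleR c)) l) = c *\<^sub>R decomp_val l"
  by (induction l) (auto simp: decomp_val_def algebra_simps linear_scale[OF regop_linear])

lemma decomp_val_le:
  assumes "l \<in> decomps A x" "\<And>T. T \<in> A \<Longrightarrow> T \<le> B"
  shows "decomp_val l \<le> regop_apply B x"
proof -
  have "decomp_val l \<le> regop_apply B (sum_list (map snd l))" if "set l \<subseteq> A \<times> {0..}"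
    using that
  proof (induction l)
    case (Cons p l)
    then obtain T y where "p = (T, y)" "T \<in> A" "0 \<le> y" by auto
    moreover from this assms(2) have "regop_apply T y \<le> regop_apply B y"
      by (auto simp: less_eq_regop_def)
    ultimately show ?case using Cons
      by (auto simp: decomp_val_def linear_add[OF regop_linear] intro!: add_mono)
  qed (simp add: decomp_val_def linear_0[OF regop_linear])
  with assms(1) show ?thesis by (auto simp: decomps_def)
qed

lemma regop_lub_exists:
  fixes A :: "'a::dedekind_complete_vector_lattice regop set"
  assumes "A \<noteq> {}" and B: "\<And>T. T \<in> A \<Longrightarrow> T \<le> B"
  obtains U where "\<And>T. T \<in> A \<Longrightarrow> T \<le> U" "\<And>V. (\<And>T. T \<in> A \<Longrightarrow> T \<le> V) \<Longrightarrow> U \<le> V"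
proof -
  define f where "f x = Sup (decomp_val ` decomps A x)" for x
  obtain T0 where T0: "T0 \<in> A" using assms by blast
  have single: "[(T, x)] \<in> decomps A x" if "T \<in> A" "0 \<le> x" for T x
    using that by (simp add: decomps_def)
  have bdd: "bdd_above (decomp_val ` decomps A x)" for x
    using decomp_val_le[OF _ B] by (intro bdd_aboveI[of _ "regop_apply B x"]) blast
  have up: "decomp_val l \<le> f x" if "l \<in> decomps A x" for l x
    unfolding f_def using that by (intro cSup_upper bdd imageI)
  have least: "f x \<le> v" if "0 \<le> x" "\<And>l. l \<in> decomps A x \<Longrightarrow> decomp_val l \<le> v" for x v
    unfolding f_def by (rule cSup_least) (use that single[OF T0] in auto)
  have add: "f (x + y) = f x + f y" if "0 \<le> x" "0 \<le> y" for x y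
  proof (rule antisym)
    show "f (x + y) \<le> f x + f y"
    proof (rule least)
      fix l assume "l \<in> decomps A (x + y)"
      from decomps_split[OF this that] obtain l1 l2 where
        "l1 \<in> decomps A x" "l2 \<in> decomps A y" "decomp_val l = decomp_val l1 + decomp_val l2"
        by blast
      then show "decomp_val l \<le> f x + f y" by (simp add: add_mono up)
    qed (use that in simp)
    have "f x \<le> f (x + y) - f y"
    proof (rule least)
      fix l assume l: "l \<in> decomps A x"
      have "f y \<le> f (x + y) - decomp_val l"
      proof (rule least)
        fix m assume "m \<in> decomps A y"
        from up[OF decomps_append[OF l this]]
        show "decomp_val m \<le> f (x + y) - decomp_val l"
          by (simp add: decomp_val_append algebra_simps)
      qed fact
      then show "decomp_val l \<le> f (x + y) - f y" by (simp add: algebra_simps)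
    qed fact
    then show "f x + f y \<le> f (x + y)" by (simp add: algebra_simps)
  qed
  have scale1: "c *\<^sub>R f x \<le> f (c *\<^sub>R x)" if "0 < c" "0 \<le> x" for c x
  proof -
    have "f x \<le> inverse c *\<^sub>R f (c *\<^sub>R x)"
    proof (rule least)
      fix l assume "l \<in> decomps A x"
      then have "decomp_val (map (map_prod id (scaleR c)) l) \<le> f (c *\<^sub>R x)"
        using that by (intro up decomps_scale) auto
      then have "inverse c *\<^sub>R (c *\<^sub>R decomp_val l) \<le> inverse c *\<^sub>R f (c *\<^sub>R x)"
        using that by (intro scaleR_left_mono) (auto simp: decomp_val_scale)
      then show "decomp_val l \<le> inverse c *\<^sub>R f (c *\<^sub>R x)" using that by simp
    qed fact
    then have "c *\<^sub>R f x \<le> c *\<^sub>R (inverse c *\<^sub>R f (c *\<^sub>R x))"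
      using that by (intro scaleR_left_mono) auto
    then show ?thesis using that by simp
  qed
  have scale: "f (c *\<^sub>R x) = c *\<^sub>R f x" if "0 < c" "0 \<le> x" for c x
  proof (rule antisym)
    have "inverse c *\<^sub>R f (c *\<^sub>R x) \<le> f x"
      using scale1[of "inverse c" "c *\<^sub>R x"] that by (simp add: scaleR_nonneg_nonneg)
    then have "c *\<^sub>R (inverse c *\<^sub>R f (c *\<^sub>R x)) \<le> c *\<^sub>R f x"
      using that by (intro scaleR_left_mono) auto
    then show "f (c *\<^sub>R x) \<le> c *\<^sub>R f x" using that by simp
  qed (rule scale1[OF that])
  from linear_extension_from_cone[of f, OF add scale] obtain F where
    F: "linear F" "\<And>x. 0 \<le> x \<Longrightarrow> F x = f x" by blast
  have ge: "regop_apply T x \<le> F x" if "T \<in> A" "0 \<le> x" for T x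
    using up[OF single[OF that]] F(2)[OF that(2)] by (simp add: decomp_val_def)
  obtain P Q where PQ: "positive_operator P" "positive_operator Q"
    "\<And>x. regop_apply T0 x = P x - Q x" by (rule regop_cases[of T0]) blast
  have pos: "positive_operator (\<lambda>x. F x - regop_apply T0 x)"
    using ge[OF T0] F(1) by (simp add: positive_operator_def linear_compose_sub regop_linear)
  have "\<exists>P Q. positive_operator P \<and> positive_operator Q \<and> F = (\<lambda>x. P x - Q x)"
    using positive_operator_add[OF pos PQ(1)] PQ(2)
    by (intro exI[of _ "\<lambda>x. F x - regop_apply T0 x + P x"] exI[of _ Q]) (auto simp: PQ(3))
  then have U: "regop_apply (Regop F) = F" by (intro Regop_inverse) simp
  show ?thesis
  proof (rule that[of "Regop F"])
    show "T \<le> Regop F" if "T \<in> A" for T using ge that by (simp add: less_eq_regop_def U)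
    show "Regop F \<le> V" if "\<And>T. T \<in> A \<Longrightarrow> T \<le> V" for V
      using least decomp_val_le[OF _ that] by (simp add: less_eq_regop_def U F(2))
  qed
qed

instantiation regop :: (dedekind_complete_vector_lattice) dedekind_complete_vector_lattice
begin

definition Sup_regop :: "'a regop set \<Rightarrow> 'a regop" where
  "Sup A = (THE U. (\<forall>T\<in>A. T \<le> U) \<and> (\<forall>V. (\<forall>T\<in>A. T \<le> V) \<longrightarrow> U \<le> V))" for A :: "'a regop set"

definition Inf_regop :: "'a regop set \<Rightarrow> 'a regop" where
  "Inf A = - Sup (uminus ` A)" for A :: "'a regop set"

definition sup_regop :: "'a regop \<Rightarrow> 'a regop \<Rightarrow> 'a regop" where
  "sup S T = Sup {S, T}" for S T :: "'a regop"

definition inf_regop :: "'a regop \<Rightarrow> 'a regop \<Rightarrow> 'a regop" where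
  "inf S T = Inf {S, T}" for S T :: "'a regop"

lemma Sup_regop_lub:
  fixes A :: "'a regop set"
  assumes "A \<noteq> {}" "bdd_above A"
  shows "\<forall>T\<in>A. T \<le> Sup A" "\<And>V. (\<And>T. T \<in> A \<Longrightarrow> T \<le> V) \<Longrightarrow> Sup A \<le> V"
proof -
  from assms obtain B where "\<And>T. T \<in> A \<Longrightarrow> T \<le> B" by (auto simp: bdd_above_def)
  with assms(1) obtain U where U: "\<And>T. T \<in> A \<Longrightarrow> T \<le> U"
    "\<And>V. (\<And>T. T \<in> A \<Longrightarrow> T \<le> V) \<Longrightarrow> U \<le> V" by (rule regop_lub_exists) blast+
  have "Sup A = U" unfolding Sup_regop_def
    by (rule the_equality) (use U in \<open>auto intro!: antisym\<close>)
  with U show "\<forall>T\<in>A. T \<le> Sup A" "\<And>V. (\<And>T. T \<in> A \<Longrightarrow> T \<le> V) \<Longrightarrow> Sup A \<le> V" by auto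
qed

lemma Inf_regop_glb:
  fixes A :: "'a regop set"
  assumes "A \<noteq> {}" "bdd_below A"
  shows "\<forall>T\<in>A. Inf A \<le> T" "\<And>V. (\<And>T. T \<in> A \<Longrightarrow> V \<le> T) \<Longrightarrow> V \<le> Inf A"
proof -
  have *: "uminus ` A \<noteq> {}" "bdd_above (uminus ` A)"
    using assms by (auto simp: bdd_below_def intro!: bdd_aboveI)
  show "\<forall>T\<in>A. Inf A \<le> T" using Sup_regop_lub(1)[OF *] by (auto simp: Inf_regop_def minus_le_iff)
  show "V \<le> Inf A" if "\<And>T. T \<in> A \<Longrightarrow> V \<le> T" for V
  proof -
    have "Sup (uminus ` A) \<le> - V" by (rule Sup_regop_lub(2)[OF *]) (use that in auto)
    then show ?thesis by (simp add: Inf_regop_def le_minus_iff)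
  qed
qed

lemma regop_pair_bdd_above: "bdd_above {S, T :: 'a regop}"
proof -
  obtain P Q where PQ: "positive_operator P" "positive_operator Q"
    "\<And>x. regop_apply S x = P x - Q x" by (rule regop_cases[of S]) blast
  obtain P' Q' where PQ': "positive_operator P'" "positive_operator Q'"
    "\<And>x. regop_apply T x = P' x - Q' x" by (rule regop_cases[of T]) blast
  define B where "B x = P x + P' x" for x
  have B: "positive_operator B" unfolding B_def using PQ PQ' by (intro positive_operator_add)
  then have *: "regop_apply (Regop B) = B"
    by (intro Regop_inverse CollectI exI[of _ B] exI[of _ "\<lambda>x. 0"])
       (auto intro: positive_operator_0)
  have "P x - Q x \<le> B x" "P' x - Q' x \<le> B x" if "0 \<le> x" for x
  proof -
    have "0 \<le> P x" "0 \<le> Q x" "0 \<le> P' x" "0 \<le> Q' x"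
      using PQ PQ' that by (auto simp: positive_operator_def)
    then have "P x \<le> P x + P' x" "P x - Q x \<le> P x" "P' x \<le> P x + P' x" "P' x - Q' x \<le> P' x"
      by auto
    then show "P x - Q x \<le> B x" "P' x - Q' x \<le> B x" unfolding B_def by (meson order_trans)+
  qed
  then have "S \<le> Regop B" "T \<le> Regop B" by (auto simp: less_eq_regop_def * PQ(3) PQ'(3))
  then show ?thesis by (intro bdd_aboveI[of _ "Regop B"]) auto
qed

lemma regop_pair_bdd_below: "bdd_below {S, T :: 'a regop}"
proof -
  obtain B where "- S \<le> B" "- T \<le> B"
    using regop_pair_bdd_above[of "- S" "- T"] by (auto simp: bdd_above_def)
  then show ?thesis by (intro bdd_belowI[of _ "- B"]) (auto simp: minus_le_iff)
qed

instance
proof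
  fix S T U :: "'a regop" and A :: "'a regop set"
  note sup = Sup_regop_lub[of "{S, T}", OF _ regop_pair_bdd_above]
  note inf = Inf_regop_glb[of "{S, T}", OF _ regop_pair_bdd_below]
  show "S \<le> sup S T" "T \<le> sup S T" using sup(1) by (auto simp: sup_regop_def)
  show "inf S T \<le> S" "inf S T \<le> T" using inf(1) by (auto simp: inf_regop_def)
  show "S \<le> inf T U" if "S \<le> T" "S \<le> U"
    using Inf_regop_glb(2)[of "{T, U}", OF _ regop_pair_bdd_below] that
    by (auto simp: inf_regop_def)
  show "sup T U \<le> S" if "T \<le> S" "U \<le> S"
    using Sup_regop_lub(2)[of "{T, U}", OF _ regop_pair_bdd_above] that
    by (auto simp: sup_regop_def)
  show "T \<le> Sup A" if "T \<in> A" "bdd_above A" using Sup_regop_lub(1)[of A] that by auto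
  show "Sup A \<le> T" if "A \<noteq> {}" "\<And>S. S \<in> A \<Longrightarrow> S \<le> T"
    by (rule Sup_regop_lub(2)) (use that in \<open>auto simp: bdd_above_def\<close>)
  show "Inf A \<le> T" if "T \<in> A" "bdd_below A" using Inf_regop_glb(1)[of A] that by auto
  show "T \<le> Inf A" if "A \<noteq> {}" "\<And>S. S \<in> A \<Longrightarrow> T \<le> S"
    by (rule Inf_regop_glb(2)) (use that in \<open>auto simp: bdd_below_def\<close>)
qed

end


section \<open>Complexification\<close>

text \<open>\<open>Cx x y\<close> stands for \<open>x + i y\<close>. The same type constructor yields \<open>E\<^sub>C\<close> from \<open>E\<close> and
  \<open>L\<^sub>r(E\<^sub>C)\<close> from \<open>L\<^sub>r(E)\<close>.\<close>

datatype 'a complexification = Cx (re: 'a) (im: 'a)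

instantiation complexification :: (real_vector) real_vector
begin

definition "0 = Cx 0 0"
definition "z + w = Cx (re z + re w) (im z + im w)"
definition "- z = Cx (- re z) (- im z)"
definition "z - w = Cx (re z - re w) (im z - im w)"
definition "c *\<^sub>R z = Cx (c *\<^sub>R re z) (c *\<^sub>R im z)"

instance
  by standard
     (auto simp: zero_complexification_def plus_complexification_def uminus_complexification_def
        minus_complexification_def scaleR_complexification_def algebra_simps)

end

lemma complexification_sel [simp]:
  "re 0 = 0" "im 0 = 0" "re (z + w) = re z + re w" "im (z + w) = im z + im w"
  "re (- z) = - re z" "im (- z) = - im z" "re (z - w) = re z - re w" "im (z - w) = im z - im w"
  "re (c *\<^sub>R z) = c *\<^sub>R re z" "im (c *\<^sub>R z) = c *\<^sub>R im z"
  by (simp_all add: zero_complexification_def plus_complexification_def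
      uminus_complexification_def minus_complexification_def scaleR_complexification_def)

definition scaleC :: "complex \<Rightarrow> 'a::real_vector complexification \<Rightarrow> 'a complexification" where
  "scaleC c z = Cx (Re c *\<^sub>R re z - Im c *\<^sub>R im z) (Re c *\<^sub>R im z + Im c *\<^sub>R re z)"

definition modulus ::
    "'a::dedekind_complete_vector_lattice complexification \<Rightarrow> 'a" where
  "modulus z = (SUP \<theta>\<in>{0..2 * pi}. cos \<theta> *\<^sub>R re z + sin \<theta> *\<^sub>R im z)"

lemma scaleR_le_sup_minus:
  fixes x :: "'a::dedekind_complete_vector_lattice"
  assumes "\<bar>c\<bar> \<le> 1"
  shows "c *\<^sub>R x \<le> sup x (- x)"
proof -
  define u where "u = sup x (- x)"
  have u: "x \<le> u" "- x \<le> u" by (auto simp: u_def)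
  have "x + - x \<le> u + u" using u by (rule add_mono)
  then have "0 \<le> u" by simp
  have "c *\<^sub>R x \<le> \<bar>c\<bar> *\<^sub>R u"
  proof (cases "0 \<le> c")
    case True
    then show ?thesis using u by (simp add: scaleR_left_mono)
  next
    case False
    then have "(- c) *\<^sub>R (- x) \<le> (- c) *\<^sub>R u" using u by (intro scaleR_left_mono) auto
    then show ?thesis using False by simp
  qed
  also have "\<dots> \<le> 1 *\<^sub>R u" using assms \<open>0 \<le> u\<close> by (rule scaleR_right_mono)
  finally show ?thesis by (simp add: u_def)
qed

lemma bdd_above_modulus:
  "bdd_above ((\<lambda>\<theta>. cos \<theta> *\<^sub>R x + sin \<theta> *\<^sub>R y) ` {0..2 * pi})"
  for x y :: "'a::dedekind_complete_vector_lattice"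
  by (intro bdd_aboveI2[of _ _ "sup x (- x) + sup y (- y)"] add_mono scaleR_le_sup_minus) auto

lemma modulus_upper:
  "\<theta> \<in> {0..2 * pi} \<Longrightarrow> cos \<theta> *\<^sub>R re z + sin \<theta> *\<^sub>R im z \<le> modulus z"
  unfolding modulus_def by (rule cSUP_upper[OF _ bdd_above_modulus])

lemma modulus_least:
  "(\<And>\<theta>. \<theta> \<in> {0..2 * pi} \<Longrightarrow> cos \<theta> *\<^sub>R re z + sin \<theta> *\<^sub>R im z \<le> u) \<Longrightarrow> modulus z \<le> u"
  unfolding modulus_def by (rule cSUP_least) auto

lemma modulus_ge:
  "re z \<le> modulus z" "- re z \<le> modulus z" "im z \<le> modulus z" "- im z \<le> modulus z"
proof -
  show "re z \<le> modulus z" "- re z \<le> modulus z" "im z \<le> modulus z"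
    using modulus_upper[of 0 z] modulus_upper[of pi z] modulus_upper[of "pi / 2" z] by simp_all
  have "sin (3 * pi / 2) = - 1" "cos (3 * pi / 2) = 0"
    using sin_3over2_pi cos_3over2_pi by (simp_all add: field_simps)
  then show "- im z \<le> modulus z"
    using modulus_upper[of "3 * pi / 2" z] by (simp add: field_simps)
qed

lemma modulus_nonneg: "0 \<le> modulus z"
proof -
  have "re z + - re z \<le> modulus z + modulus z" using modulus_ge by (intro add_mono)
  then show ?thesis by simp
qed

lemma modulus_0: "modulus 0 = 0"
  by (simp add: modulus_def)

lemma modulus_eq_0: "modulus z = 0 \<Longrightarrow> z = 0"
  using modulus_ge[of z] by (cases z) (auto simp: zero_complexification_def intro: antisym)

lemma modulus_triangle: "modulus (z + w) \<le> modulus z + modulus w"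
proof (rule modulus_least)
  fix \<theta> :: real assume "\<theta> \<in> {0..2 * pi}"
  from add_mono[OF modulus_upper[OF this, of z] modulus_upper[OF this, of w]]
  show "cos \<theta> *\<^sub>R re (z + w) + sin \<theta> *\<^sub>R im (z + w) \<le> modulus z + modulus w"
    by (simp add: algebra_simps)
qed

lemma modulus_scaleR_pos:
  assumes "0 < c"
  shows "modulus (c *\<^sub>R z) = c *\<^sub>R modulus z"
proof -
  have le: "modulus (c *\<^sub>R z) \<le> c *\<^sub>R modulus z" if "0 < c" for c and z :: "'a complexification"
  proof (rule modulus_least)
    fix \<theta> :: real assume "\<theta> \<in> {0..2 * pi}"
    from scaleR_left_mono[OF modulus_upper[OF this, of z], of c] that
    show "cos \<theta> *\<^sub>R re (c *\<^sub>R z) + sin \<theta> *\<^sub>R im (c *\<^sub>R z) \<le> c *\<^sub>R modulus z"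
      by (simp add: algebra_simps)
  qed
  have "modulus (inverse c *\<^sub>R (c *\<^sub>R z)) \<le> inverse c *\<^sub>R modulus (c *\<^sub>R z)"
    using assms by (intro le) auto
  then have "c *\<^sub>R modulus z \<le> c *\<^sub>R (inverse c *\<^sub>R modulus (c *\<^sub>R z))"
    using assms by (intro scaleR_left_mono) auto
  with le[OF assms, of z] assms show ?thesis by (intro antisym) auto
qed

lemma modulus_minus: "modulus (- z) = modulus z"
proof -
  have le: "modulus (- z) \<le> modulus z" for z :: "'a complexification"
  proof (rule modulus_least)
    fix \<theta> :: real assume \<theta>: "\<theta> \<in> {0..2 * pi}"
    define \<phi> where "\<phi> = (if \<theta> \<le> pi then \<theta> + pi else \<theta> - pi)"
    have "\<phi> \<in> {0..2 * pi}" "cos \<phi> = - cos \<theta>" "sin \<phi> = - sin \<theta>"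
      using \<theta> by (auto simp: \<phi>_def cos_diff sin_diff)
    then show "cos \<theta> *\<^sub>R re (- z) + sin \<theta> *\<^sub>R im (- z) \<le> modulus z"
      using modulus_upper[of \<phi> z] by simp
  qed
  from le[of z] le[of "- z"] show ?thesis by (simp add: antisym)
qed

lemma modulus_scaleR: "modulus (c *\<^sub>R z) = \<bar>c\<bar> *\<^sub>R modulus z"
proof -
  consider "c > 0" | "c = 0" | "c < 0" by linarith
  then show ?thesis
  proof cases
    case 3
    then show ?thesis using modulus_scaleR_pos[of "- c" z] by (simp add: modulus_minus)
  qed (simp_all add: modulus_scaleR_pos modulus_0)
qed

instantiation complexification :: (dedekind_complete_banach_lattice) real_normed_vector
begin

definition norm_complexification :: "'a complexification \<Rightarrow> real" where
  "norm z = norm (modulus z)" for z :: "'a complexification"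

definition dist_complexification :: "'a complexification \<Rightarrow> 'a complexification \<Rightarrow> real" where
  "dist z w = norm (z - w)" for z w :: "'a complexification"

definition sgn_complexification :: "'a complexification \<Rightarrow> 'a complexification" where
  "sgn z = inverse (norm z) *\<^sub>R z" for z :: "'a complexification"

definition uniformity_complexification ::
    "('a complexification \<times> 'a complexification) filter" where
  "uniformity_complexification = (INF e\<in>{0 <..}. principal {(z, w). dist z w < e})"

definition open_complexification :: "'a complexification set \<Rightarrow> bool" where
  "open_complexification U \<longleftrightarrow> (\<forall>z\<in>U. eventually (\<lambda>(z', w). z' = z \<longrightarrow> w \<in> U) uniformity)"

instance
proof
  fix z w :: "'a complexification" and c :: real and U :: "'a complexification set"
  show "dist z w = norm (z - w)" by (rule dist_complexification_def)
  show "sgn z = z /\<^sub>R norm z" by (rule sgn_complexification_def)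
  show "uniformity =
      (INF e\<in>{0 <..}. principal {(z, w :: 'a complexification). dist z w < e})"
    by (rule uniformity_complexification_def)
  show "open U \<longleftrightarrow> (\<forall>z\<in>U. \<forall>\<^sub>F (z', w) in uniformity. z' = z \<longrightarrow> w \<in> U)"
    by (rule open_complexification_def)
  show "norm z = 0 \<longleftrightarrow> z = 0"
    by (auto simp: norm_complexification_def modulus_0 dest: modulus_eq_0)
  have "norm (modulus (z + w)) \<le> norm (modulus z + modulus w)"
    by (rule norm_mono_abs)
       (simp add: abs_of_nonneg modulus_nonneg add_nonneg_nonneg modulus_triangle)
  then show "norm (z + w) \<le> norm z + norm w"
    unfolding norm_complexification_def by (rule order_trans) (rule norm_triangle_ineq)
  show "norm (c *\<^sub>R z) = \<bar>c\<bar> * norm z"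
    by (simp add: norm_complexification_def modulus_scaleR)
qed

end


section \<open>The centre and its three norms\<close>

text \<open>The action of \<open>T = R + iS\<close> on \<open>x + iy\<close>.\<close>

definition cx_apply ::
    "'a::ordered_real_vector regop complexification \<Rightarrow> 'a complexification \<Rightarrow> 'a complexification" where
  "cx_apply T z =
     Cx (regop_apply (re T) (re z) - regop_apply (im T) (im z))
        (regop_apply (re T) (im z) + regop_apply (im T) (re z))"

lemma cx_apply_scaleC: "cx_apply T (scaleC c z) = scaleC c (cx_apply T z)"
  by (simp add: cx_apply_def scaleC_def algebra_simps linear_add[OF regop_linear]
      linear_diff[OF regop_linear] linear_scale[OF regop_linear])

definition centre :: "'a::dedekind_complete_vector_lattice regop complexification set" where
  "centre = {T. \<exists>c\<ge>0. modulus T \<le> c *\<^sub>R id_regop}"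

definition order_unit_norm ::
    "'a::dedekind_complete_vector_lattice regop complexification \<Rightarrow> real" where
  "order_unit_norm T = Inf {c. 0 \<le> c \<and> modulus T \<le> c *\<^sub>R id_regop}"

text \<open>Positive operators on a Banach lattice are automatically bounded, so the following
  \<^const>\<open>onorm\<close> is a supremum of a bounded set of reals.\<close>

definition regular_norm ::
    "'a::dedekind_complete_banach_lattice regop complexification \<Rightarrow> real" where
  "regular_norm T = onorm (regop_apply (modulus T))"

end

(* Put T = R + iS. If D is central then D^+ D^- = 0, so for y = D^+ x with x >= 0 we have D y >= 0.
   If |T| is not below c I, then for some angle t neither is A = R cos t + S sin t, and D = A - c I
   yields y > 0 with A y >= c y; as |T| y and the modulus of T y both dominate A y, the regular
   norm and the operator norm are at least c.

   Conversely |T| <= c I gives |T z| <= (c + e) |z| for every e > 0. After a rotation it suffices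
   to bound the real part R x - S y. If w = R x - S y - (c + e) |z| were not negative, a product H of
   positive parts of operators of the form +-(R - a I), +-(S - b I) would localise to where R and S
   are within a small d of constants l and s while H w is still not negative. There
   sqrt (l^2 + s^2) <= c + 2 d, and l x - s y <= sqrt (l^2 + s^2) |z| gives a contradiction. *)

theory Submission
  imports Defs
begin

section \<open>Disjoint positive parts and positive operators\<close>

text \<open>Both entries are translates by \<open>pprt (- x)\<close>, of \<open>x\<close> and of
  \<open>0\<close>, so the infimum is \<open>inf x 0 + pprt (- x)\<close>, which cancels.\<close>

lemma inf_pprt_pprt_minus: "inf (pprt x) (pprt (- x)) = 0"
  for x :: "'a::lattice_ab_group_add"
proof -
  have "inf (pprt x) (pprt (- x)) = inf (x + pprt (- x)) (0 + pprt (- x))"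
    by (metis add.left_neutral diff_add_cancel pprt_minus)
  also have "\<dots> = inf x 0 + pprt (- x)" by (rule add_inf_distrib_right[symmetric])
  also have "\<dots> = 0" by (simp add: pprt_neg nprt_def[symmetric])
  finally show ?thesis .
qed

text \<open>Dividing by \<open>k\<close> puts \<open>v\<close> below both \<open>p\<close> and
  \<open>q\<close>, hence below their infimum 0.\<close>

lemma scaleR_le_disjoint_imp_nonpos:
  fixes p q v :: "'a::dedekind_complete_vector_lattice"
  assumes "0 < k" "v \<le> k *\<^sub>R p" "v \<le> k *\<^sub>R q" "inf p q = 0"
  shows "v \<le> 0"
proof -
  have "inverse k *\<^sub>R v \<le> r" if "v \<le> k *\<^sub>R r" for r
    using scaleR_left_mono[OF that, of "inverse k"] assms(1) by simp
  then have "inverse k *\<^sub>R v \<le> inf p q" using assms(2,3) by (intro le_infI)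
  then have "inverse k *\<^sub>R v \<le> 0" using assms(4) by simp
  then have "k *\<^sub>R (inverse k *\<^sub>R v) \<le> k *\<^sub>R 0" using assms by (intro scaleR_left_mono) auto
  then show ?thesis using assms(1) by simp
qed

lemma positive_operator_pprt: "positive_operator (regop_apply (pprt D))"
  for D :: "'a::dedekind_complete_vector_lattice regop"
proof -
  have "0 \<le> pprt D" by simp
  then show ?thesis
    by (auto simp: positive_operator_def regop_linear less_eq_regop_def zero_regop.rep_eq)
qed

lemma positive_operator_mono:
  assumes "positive_operator P" "x \<le> y"
  shows "P x \<le> P y"
proof -
  have "0 \<le> P (y - x)" using assms by (simp add: positive_operator_def)
  then show ?thesis using assms(1) by (simp add: positive_operator_def linear_diff)
qed

lemma regop_apply_pprt_diff:
  "regop_apply D x = regop_apply (pprt D) x - regop_apply (pprt (- D)) x"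
  for D :: "'a::dedekind_complete_vector_lattice regop"
  by (metis minus_regop_apply pprt_minus)

lemma regop_apply_mono: "S \<le> T \<Longrightarrow> 0 \<le> x \<Longrightarrow> regop_apply S x \<le> regop_apply T x"
  for S T :: "'a::dedekind_complete_vector_lattice regop"
  by (simp add: less_eq_regop_def)


section \<open>Central operators\<close>

text \<open>The real centre, with the bound on the modulus of \<open>D\<close> split into two
  inequalities. A positive \<open>k\<close> can later be divided by.\<close>

definition central_regop :: "'a::dedekind_complete_vector_lattice regop \<Rightarrow> bool" where
  "central_regop D \<longleftrightarrow> (\<exists>k>0. D \<le> k *\<^sub>R id_regop \<and> - D \<le> k *\<^sub>R id_regop)"

text \<open>The operators used to localise. They are plain functions, so that products are mere
  compositions.\<close>

definition central_positive ::
    "('a::dedekind_complete_vector_lattice \<Rightarrow> 'a) \<Rightarrow> bool" where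
  "central_positive H \<longleftrightarrow> positive_operator H \<and> (\<exists>k>0. \<forall>x\<ge>0. H x \<le> k *\<^sub>R x)"

lemma id_regop_nonneg: "0 \<le> (id_regop :: 'a::dedekind_complete_vector_lattice regop)"
  by (simp add: less_eq_regop_def zero_regop.rep_eq id_regop.rep_eq)

lemma central_regop_minus: "central_regop D \<Longrightarrow> central_regop (- D)"
  by (auto simp: central_regop_def)

lemma central_regop_add:
  assumes "central_regop D" "central_regop D'"
  shows "central_regop (D + D')"
proof -
  obtain k k' where k: "k > 0" "D \<le> k *\<^sub>R id_regop" "- D \<le> k *\<^sub>R id_regop"
    "k' > 0" "D' \<le> k' *\<^sub>R id_regop" "- D' \<le> k' *\<^sub>R id_regop"
    using assms by (auto simp: central_regop_def)
  have "D + D' \<le> (k + k') *\<^sub>R id_regop" "- D + - D' \<le> (k + k') *\<^sub>R id_regop"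
    unfolding scaleR_add_left using k by (auto intro: add_mono simp only:)
  then show ?thesis unfolding central_regop_def
    using k by (intro exI[of _ "k + k'"]) auto
qed

lemma central_regop_scaleR_id:
  "central_regop (c *\<^sub>R id_regop :: 'a::dedekind_complete_vector_lattice regop)"
proof -
  have "c *\<^sub>R id_regop \<le> (\<bar>c\<bar> + 1) *\<^sub>R (id_regop :: 'a regop)"
    "(- c) *\<^sub>R id_regop \<le> (\<bar>c\<bar> + 1) *\<^sub>R (id_regop :: 'a regop)"
    by (intro scaleR_right_mono id_regop_nonneg; simp)+
  then show ?thesis unfolding central_regop_def by (intro exI[of _ "\<bar>c\<bar> + 1"]) auto
qed

lemma central_regop_shift:
  assumes "central_regop D"
  shows "central_regop (D - c *\<^sub>R id_regop)" "central_regop (c *\<^sub>R id_regop - D)"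
  using central_regop_add[OF assms central_regop_scaleR_id[of "- c"]]
    central_regop_add[OF central_regop_minus[OF assms] central_regop_scaleR_id[of c]]
  by simp_all

text \<open>\<open>pprt D\<close> is the supremum of \<open>D\<close> and 0, and a positive multiple
  of the identity dominates both.\<close>

lemma central_positive_pprt:
  assumes "central_regop D"
  shows "central_positive (regop_apply (pprt D))"
proof -
  obtain k where k: "k > 0" "D \<le> k *\<^sub>R id_regop" using assms by (auto simp: central_regop_def)
  moreover have "0 \<le> k *\<^sub>R (id_regop :: 'a regop)"
    using k by (simp add: scaleR_nonneg_nonneg id_regop_nonneg)
  ultimately have "pprt D \<le> k *\<^sub>R id_regop" by (simp add: pprt_def)
  then have "regop_apply (pprt D) x \<le> k *\<^sub>R x" if "0 \<le> x" for x
    using regop_apply_mono[OF _ that] by (force simp: scaleR_regop.rep_eq id_regop.rep_eq)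
  with k(1) show ?thesis
    by (auto simp: central_positive_def positive_operator_pprt)
qed

lemma positive_operator_comp:
  "positive_operator P \<Longrightarrow> positive_operator Q \<Longrightarrow> positive_operator (\<lambda>x. P (Q x))"
  using linear_compose[of Q P] by (auto simp: positive_operator_def comp_def)

lemma central_positive_comp:
  assumes "central_positive G" "central_positive H"
  shows "central_positive (\<lambda>x. G (H x))"
proof -
  obtain k k' where k: "k > 0" "\<And>x. 0 \<le> x \<Longrightarrow> G x \<le> k *\<^sub>R x"
    "k' > 0" "\<And>x. 0 \<le> x \<Longrightarrow> H x \<le> k' *\<^sub>R x"
    using assms by (auto simp: central_positive_def)
  have "G (H x) \<le> (k * k') *\<^sub>R x" if "0 \<le> x" for x
  proof -
    have "0 \<le> H x" using assms that by (auto simp: central_positive_def positive_operator_def)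
    then have "G (H x) \<le> k *\<^sub>R H x" using k by auto
    also have "\<dots> \<le> k *\<^sub>R (k' *\<^sub>R x)" using k that by (intro scaleR_left_mono) auto
    finally show ?thesis by simp
  qed
  moreover have "positive_operator (\<lambda>x. G (H x))"
    using assms by (auto simp: central_positive_def intro: positive_operator_comp[of G H])
  ultimately show ?thesis using k(1,3)
    by (auto simp: central_positive_def intro!: exI[of _ "k * k'"])
qed

text \<open>Since both parts are dominated by multiples of the identity, their product lies below
  multiples of each of them, which are disjoint.\<close>

lemma central_regop_parts_comp:
  assumes "central_regop D" "0 \<le> x"
  shows "regop_apply (pprt D) (regop_apply (pprt (- D)) x) = 0"
proof -
  define P where "P = regop_apply (pprt D)"
  define N where "N = regop_apply (pprt (- D))"
  have pos: "positive_operator P" "positive_operator N"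
    by (simp_all add: P_def N_def positive_operator_pprt)
  obtain k l where kl: "k > 0" "\<And>x. 0 \<le> x \<Longrightarrow> P x \<le> k *\<^sub>R x"
      "l > 0" "\<And>x. 0 \<le> x \<Longrightarrow> N x \<le> l *\<^sub>R x"
    using central_positive_pprt[OF assms(1)]
      central_positive_pprt[OF central_regop_minus[OF assms(1)]]
    by (auto simp: central_positive_def P_def N_def)
  \<comment> \<open>The two parts are known to be disjoint only in the lattice of operators, so
    their product has to become an element of that lattice.\<close>
  define V where "V = Regop (\<lambda>x. P (N x))"
  have V: "regop_apply V = (\<lambda>x. P (N x))" unfolding V_def
    by (intro Regop_inverse CollectI exI[of _ "\<lambda>x. P (N x)"] exI[of _ "\<lambda>x. 0"])
       (auto intro: positive_operator_0 positive_operator_comp[OF pos])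
  \<comment> \<open>The disjointness argument takes one common multiple for both bounds.\<close>
  define m where "m = max k l"
  have m: "0 < m" "k \<le> m" "l \<le> m" using kl by (auto simp: m_def)
  have "P (N x) \<le> m *\<^sub>R P x" if "0 \<le> x" for x
  proof -
    have "P (N x) \<le> P (l *\<^sub>R x)" using kl that by (intro positive_operator_mono[OF pos(1)]) auto
    also have "\<dots> = l *\<^sub>R P x" using pos by (simp add: positive_operator_def linear_scale)
    also have "\<dots> \<le> m *\<^sub>R P x"
      using m pos that by (intro scaleR_right_mono) (auto simp: positive_operator_def)
    finally show ?thesis .
  qed
  moreover have "P (N x) \<le> m *\<^sub>R N x" if "0 \<le> x" for x
  proof -
    have N: "0 \<le> N x" using pos that by (auto simp: positive_operator_def)
    then have "P (N x) \<le> k *\<^sub>R N x" using kl by auto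
    also have "\<dots> \<le> m *\<^sub>R N x" using m N by (intro scaleR_right_mono)
    finally show ?thesis .
  qed
  ultimately have "V \<le> m *\<^sub>R pprt D" "V \<le> m *\<^sub>R pprt (- D)"
    by (auto simp: less_eq_regop_def V scaleR_regop.rep_eq P_def N_def)
  then have "V \<le> 0"
    by (rule scaleR_le_disjoint_imp_nonpos[OF m(1) _ _ inf_pprt_pprt_minus])
  then have "P (N x) \<le> 0"
    using regop_apply_mono[of V 0, OF _ assms(2)] by (simp add: V zero_regop.rep_eq)
  moreover have "0 \<le> P (N x)" using pos assms(2) by (auto simp: positive_operator_def)
  ultimately show ?thesis by (auto simp: P_def N_def)
qed

text \<open>From \<open>H w \<le> 0\<close> follows \<open>d *\<^sub>R pprt w \<le> H (pprt w) \<le>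
  H (pprt (- w)) \<le> k *\<^sub>R pprt (- w)\<close>. So a positive multiple of
  \<open>pprt w\<close> lies below multiples of two disjoint elements and must vanish.\<close>

lemma central_positive_reflects_nonpos:
  assumes H: "central_positive H" and d: "0 < d" "\<And>x. 0 \<le> x \<Longrightarrow> d *\<^sub>R x \<le> H x"
    and w: "H w \<le> 0"
  shows "w \<le> 0"
proof -
  obtain k where k: "k > 0" "\<And>x. 0 \<le> x \<Longrightarrow> H x \<le> k *\<^sub>R x" and lin: "linear H"
    using H by (auto simp: central_positive_def positive_operator_def)
  have "H w = H (pprt w) - H (pprt (- w))"
    by (metis lin linear_diff pprt_minus)
  then have "H (pprt w) \<le> H (pprt (- w))" using w by simp
  moreover have "d *\<^sub>R pprt w \<le> H (pprt w)" using d by simp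
  moreover have "H (pprt (- w)) \<le> k *\<^sub>R pprt (- w)" using k by simp
  moreover have "k *\<^sub>R pprt (- w) \<le> max d k *\<^sub>R pprt (- w)"
    "d *\<^sub>R pprt w \<le> max d k *\<^sub>R pprt w"
    by (intro scaleR_right_mono; simp)+
  ultimately have "d *\<^sub>R pprt w \<le> 0" using d(1)
    by (intro scaleR_le_disjoint_imp_nonpos[of "max d k" _ "pprt w" "pprt (- w)"])
       (auto intro: inf_pprt_pprt_minus order_trans)
  then have "inverse d *\<^sub>R (d *\<^sub>R pprt w) \<le> inverse d *\<^sub>R 0"
    using d(1) by (intro scaleR_left_mono) auto
  then have "pprt w \<le> 0" using d(1) by simp
  then show ?thesis by (simp add: pprt_def)
qed


section \<open>Localisation\<close>

text \<open>\<open>D\<close> is nonnegative on the carrier of \<open>H\<close>.\<close>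

definition nonneg_on_carrier ::
    "('a::dedekind_complete_vector_lattice \<Rightarrow> 'a) \<Rightarrow> 'a regop \<Rightarrow> bool" where
  "nonneg_on_carrier H D \<longleftrightarrow> (\<forall>x\<ge>0. H (regop_apply (pprt (- D)) x) = 0)"

lemma nonneg_on_carrierD:
  assumes "nonneg_on_carrier H D" "positive_operator H" "0 \<le> x"
  shows "0 \<le> H (regop_apply D x)"
proof -
  have "H (regop_apply D x) = H (regop_apply (pprt D) x) - H (regop_apply (pprt (- D)) x)"
    using assms(2) by (subst regop_apply_pprt_diff) (simp add: positive_operator_def linear_diff)
  moreover have "0 \<le> regop_apply (pprt D) x"
    using positive_operator_pprt[of D] assms(3) by (simp add: positive_operator_def)
  ultimately show ?thesis using assms by (simp add: nonneg_on_carrier_def positive_operator_def)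
qed

text \<open>The negative part decreases as the operator grows, so \<open>H\<close> applied to the
  new one is squeezed between 0 and 0.\<close>

lemma nonneg_on_carrier_mono:
  assumes "nonneg_on_carrier H D" "positive_operator H" "D \<le> D'"
  shows "nonneg_on_carrier H D'"
  unfolding nonneg_on_carrier_def
proof (intro allI impI)
  fix x :: 'a assume x: "0 \<le> x"
  have "pprt (- D') \<le> pprt (- D)" using assms(3) by (intro pprt_mono) simp
  then have "H (regop_apply (pprt (- D')) x) \<le> H (regop_apply (pprt (- D)) x)"
    using x by (intro positive_operator_mono[OF assms(2)] regop_apply_mono)
  moreover have "0 \<le> H (regop_apply (pprt (- D')) x)"
    using assms(2) positive_operator_pprt[of "- D'"] x by (simp add: positive_operator_def)
  ultimately show "H (regop_apply (pprt (- D')) x) = 0"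
    using assms(1) x by (simp add: nonneg_on_carrier_def)
qed

lemma nonneg_on_carrier_nonneg: "0 \<le> D \<Longrightarrow> positive_operator H \<Longrightarrow> nonneg_on_carrier H D"
  by (simp add: nonneg_on_carrier_def zero_regop.rep_eq positive_operator_def linear_0)

lemma nonneg_on_carrier_comp_left:
  "nonneg_on_carrier H D \<Longrightarrow> positive_operator G \<Longrightarrow> nonneg_on_carrier (\<lambda>x. G (H x)) D"
  by (simp add: nonneg_on_carrier_def positive_operator_def linear_0)

text \<open>The bound of \<open>H\<close> by \<open>k\<close> times the identity stands in for
  commuting \<open>H\<close> past the negative part of \<open>D\<close>: the composition is squeezed
  between 0 and \<open>k\<close> times 0.\<close>

lemma nonneg_on_carrier_comp_right:
  assumes "nonneg_on_carrier G D" "positive_operator G" "central_positive H"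
  shows "nonneg_on_carrier (\<lambda>x. G (H x)) D"
  unfolding nonneg_on_carrier_def
proof (intro allI impI)
  fix x :: 'a assume x: "0 \<le> x"
  define u where "u = regop_apply (pprt (- D)) x"
  obtain k where k: "\<And>x. 0 \<le> x \<Longrightarrow> H x \<le> k *\<^sub>R x" and H: "positive_operator H"
    using assms(3) by (auto simp: central_positive_def)
  have u: "0 \<le> u"
    using positive_operator_pprt[of "- D"] x by (simp add: positive_operator_def u_def)
  have "G (H u) \<le> G (k *\<^sub>R u)" by (intro positive_operator_mono[OF assms(2)] k u)
  also have "\<dots> = k *\<^sub>R G u" using assms(2) by (simp add: positive_operator_def linear_scale)
  also have "\<dots> = 0" using assms(1) x by (simp add: nonneg_on_carrier_def u_def)
  finally have "G (H u) \<le> 0" .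
  moreover have "0 \<le> G (H u)" using assms(2) H u by (simp add: positive_operator_def)
  ultimately show "G (H (regop_apply (pprt (- D)) x)) = 0" by (simp add: u_def)
qed

text \<open>Makes \<open>pprt D\<close> the tool for restricting to the region where
  \<open>D\<close> is nonnegative.\<close>

lemma nonneg_on_carrier_pprt: "central_regop D \<Longrightarrow> nonneg_on_carrier (regop_apply (pprt D)) D"
  by (simp add: nonneg_on_carrier_def central_regop_parts_comp)

text \<open>The two positive parts add up to at least \<open>d I\<close>.\<close>

lemma localise_split:
  assumes D: "central_regop D" "central_regop D'" and d: "0 < d" "D + D' = d *\<^sub>R id_regop"
    and w: "\<not> w \<le> 0"
  shows "\<not> regop_apply (pprt D) w \<le> 0 \<or> \<not> regop_apply (pprt D') w \<le> 0"
proof (rule ccontr)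
  \<comment> \<open>If both parts sent \<open>w\<close> below 0, so would their sum
    \<open>H\<close>. But \<open>H\<close> is central and dominates \<open>d\<close> times the
    identity, so it reflects \<open>w \<le> 0\<close>.\<close>
  define H where "H x = regop_apply (pprt D) x + regop_apply (pprt D') x" for x
  assume "\<not> ?thesis"
  then have Hw: "H w \<le> 0" by (auto simp: H_def intro: add_nonpos_nonpos)
  obtain k k' where k: "k > 0" "\<And>x. 0 \<le> x \<Longrightarrow> regop_apply (pprt D) x \<le> k *\<^sub>R x"
    "k' > 0" "\<And>x. 0 \<le> x \<Longrightarrow> regop_apply (pprt D') x \<le> k' *\<^sub>R x"
    using D[THEN central_positive_pprt] by (auto simp: central_positive_def)
  have "H x \<le> (k + k') *\<^sub>R x" if "0 \<le> x" for x
    using k that by (simp add: H_def scaleR_add_left add_mono)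
  moreover have "positive_operator H"
    unfolding H_def by (intro positive_operator_add positive_operator_pprt)
  ultimately have "central_positive H"
    using k by (auto simp: central_positive_def intro!: exI[of _ "k + k'"])
  moreover have "d *\<^sub>R x \<le> H x" if "0 \<le> x" for x
  proof -
    have "d *\<^sub>R id_regop \<le> pprt D + pprt D'"
      unfolding d(2)[symmetric] by (intro add_mono) (simp_all add: pprt_def)
    from regop_apply_mono[OF this that] show ?thesis
      by (simp add: H_def scaleR_regop.rep_eq id_regop.rep_eq plus_regop.rep_eq)
  qed
  ultimately have "w \<le> 0" using central_positive_reflects_nonpos d(1) Hw by blast
  with w show False by simp
qed

text \<open>A discrete spectral search: on a grid of levels, take the lowest one such that some
  \<open>H\<close> restricts to where \<open>R\<close> is below it and keeps \<open>H w\<close> from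
  being nonpositive. Just under that level a lower bound can be imposed as well.\<close>

lemma localise:
  assumes R: "central_regop R" and w: "\<not> w \<le> 0" and d: "0 < d"
  obtains H l where "central_positive H" "\<not> H w \<le> 0"
    "nonneg_on_carrier H (R - l *\<^sub>R id_regop)"
    "nonneg_on_carrier H ((l + d) *\<^sub>R id_regop - R)"
proof -
  obtain k where k: "k > 0" "R \<le> k *\<^sub>R id_regop" "- R \<le> k *\<^sub>R id_regop"
    using R by (auto simp: central_regop_def)
  \<comment> \<open>The final window spans three grid steps.\<close>
  define e where "e = d / 3"
  have e: "e > 0" "d = 3 * e" using d by (auto simp: e_def)
  \<comment> \<open>The grid starts at \<open>- k\<close>, below \<open>R\<close>. Real indices
    allow \<open>real j - 2\<close> to be negative.\<close>
  define lev where "lev i = i * e - k" for i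
  define Q where "Q n \<longleftrightarrow> (\<exists>H. central_positive H \<and> \<not> H w \<le> 0 \<and>
    nonneg_on_carrier H (lev (real n) *\<^sub>R id_regop - R))" for n
  \<comment> \<open>At a level of at least \<open>k\<close> the upper bound holds everywhere, so the
    identity serves as \<open>H\<close> and the search is not void.\<close>
  obtain n where "real n > 2 * k / e" using reals_Archimedean2 by blast
  then have "k \<le> lev (real n)" using e by (simp add: lev_def field_simps)
  then have "k *\<^sub>R id_regop \<le> lev (real n) *\<^sub>R (id_regop :: 'a regop)"
    by (intro scaleR_right_mono id_regop_nonneg)
  then have "0 \<le> lev (real n) *\<^sub>R id_regop - R" using k(2) by simp
  moreover have cid: "central_positive (\<lambda>x :: 'a. x)"
    by (auto simp: central_positive_def positive_operator_id intro!: exI[of _ 1])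
  ultimately have "Q n" unfolding Q_def using w
    by (intro exI[of _ "\<lambda>x. x"]) (auto intro!: nonneg_on_carrier_nonneg positive_operator_id)
  define i where "i = (LEAST n. Q n)"
  have "Q i" unfolding i_def by (rule LeastI) fact
  then obtain H where H: "central_positive H" "\<not> H w \<le> 0"
    "nonneg_on_carrier H (lev (real i) *\<^sub>R id_regop - R)" by (auto simp: Q_def)
  then have Hpos: "positive_operator H" by (simp add: central_positive_def)
  show ?thesis
  proof (cases i)
    \<comment> \<open>At the bottom level the lower bound \<open>- k\<close> holds everywhere, and
      \<open>H\<close> needs no further cut.\<close>
    case 0
    have "- k *\<^sub>R id_regop \<le> (- k + d) *\<^sub>R (id_regop :: 'a regop)"
      using d by (intro scaleR_right_mono id_regop_nonneg) simp
    then have "nonneg_on_carrier H ((- k + d) *\<^sub>R id_regop - R)"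
      using H(3) by (intro nonneg_on_carrier_mono[OF H(3) Hpos]) (simp add: 0 lev_def)
    moreover have "0 \<le> R - (- k) *\<^sub>R id_regop"
      using add_left_mono[OF k(3), of R] by simp
    then have "nonneg_on_carrier H (R - (- k) *\<^sub>R id_regop)"
      by (rule nonneg_on_carrier_nonneg) fact
    ultimately show ?thesis using H that by blast
  next
    case (Suc j)
    \<comment> \<open>Two steps below level \<open>j\<close>, so that the cuts
      \<open>R \<ge> l\<close> and \<open>R \<le> lev j\<close> overlap by \<open>2 * e\<close>, and
      three below level \<open>i\<close>, which gives the width \<open>d\<close>.\<close>
    define l where "l = lev (real j - 2)"
    have lev: "lev (real j) = l + 2 * e" "lev (real i) = l + d"
      by (simp_all add: l_def lev_def Suc e algebra_simps)
    define D where "D = R - l *\<^sub>R id_regop"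
    define D' where "D' = lev (real j) *\<^sub>R id_regop - R"
    have D: "central_regop D" "central_regop D'"
      using R by (simp_all add: D_def D'_def central_regop_shift)
    have "D + D' = (2 * e) *\<^sub>R id_regop" by (simp add: D_def D'_def lev scaleR_add_left)
    from localise_split[OF D _ this H(2)] e
    have "\<not> regop_apply (pprt D) (H w) \<le> 0 \<or> \<not> regop_apply (pprt D') (H w) \<le> 0" by simp
    \<comment> \<open>Minimality of \<open>i\<close> rules out that the cut by \<open>D'\<close>
      preserves the witness, so the cut by \<open>D\<close> does.\<close>
    moreover have "\<not> Q j" unfolding i_def using not_less_Least[of j Q] Suc by (simp add: i_def)
    then have "regop_apply (pprt D') (H w) \<le> 0"
      using central_positive_comp[OF central_positive_pprt[OF D(2)] H(1)]
        nonneg_on_carrier_comp_right[OF nonneg_on_carrier_pprt[OF D(2)] positive_operator_pprt H(1)]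
      unfolding Q_def D'_def by blast
    ultimately have "\<not> regop_apply (pprt D) (H w) \<le> 0" by blast
    moreover note central_positive_comp[OF central_positive_pprt[OF D(1)] H(1)]
      nonneg_on_carrier_comp_right[OF nonneg_on_carrier_pprt[OF D(1)] positive_operator_pprt H(1)]
      nonneg_on_carrier_comp_left[OF H(3) positive_operator_pprt[of D]]
    ultimately show ?thesis unfolding lev D_def by (intro that)
  qed
qed

section \<open>Estimates where an operator is nearly scalar\<close>

lemma localised_bounds:
  assumes H: "positive_operator H"
    "nonneg_on_carrier H (R - l *\<^sub>R id_regop)" "nonneg_on_carrier H ((l + d) *\<^sub>R id_regop - R)"
    and u: "0 \<le> u"
  shows "0 \<le> H (regop_apply R u) - l *\<^sub>R H u" "H (regop_apply R u) - l *\<^sub>R H u \<le> d *\<^sub>R H u"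
  using nonneg_on_carrierD[OF H(2,1) u] nonneg_on_carrierD[OF H(3,1) u] H(1)
  by (simp_all add: minus_regop_apply scaleR_regop.rep_eq id_regop.rep_eq positive_operator_def
      plus_regop.rep_eq linear_diff linear_scale linear_add algebra_simps)

lemma localised_bound_diff:
  assumes H: "positive_operator H"
    "nonneg_on_carrier H (R - l *\<^sub>R id_regop)" "nonneg_on_carrier H ((l + d) *\<^sub>R id_regop - R)"
    and m: "x \<le> m" "0 \<le> m" "0 \<le> d"
  shows "H (regop_apply R x) - l *\<^sub>R H x \<le> d *\<^sub>R H m"
proof -
  have lin: "linear H" using H by (simp add: positive_operator_def)
  define f where "f u = H (regop_apply R u) - l *\<^sub>R H u" for u
  have "f (u - v) = f u - f v" for u v
    by (simp add: f_def linear_diff[OF lin] linear_diff[OF regop_linear] algebra_simps)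
  from this[of "pprt x" "pprt (- x)"] have "f x = f (pprt x) - f (pprt (- x))"
    by (simp flip: pprt_minus)
  also have "\<dots> \<le> f (pprt x)"
    using localised_bounds(1)[OF H, of "pprt (- x)"] by (simp add: f_def)
  also have "\<dots> \<le> d *\<^sub>R H (pprt x)"
    using localised_bounds(2)[OF H, of "pprt x"] by (simp add: f_def)
  also have "\<dots> \<le> d *\<^sub>R H m"
    using m by (intro scaleR_left_mono positive_operator_mono[OF H(1)]) (auto simp: pprt_def)
  finally show ?thesis by (simp add: f_def)
qed


section \<open>The modulus of the image\<close>

text \<open>Every point of the unit circle is a cosine and sine pair with angle in
  \<open>{0..2 * pi}\<close>.\<close>

lemma modulus_upper_unit:
  assumes "a\<^sup>2 + b\<^sup>2 = 1"
  shows "a *\<^sub>R re z + b *\<^sub>R im z \<le> modulus z"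
  using sincos_total_2pi_le[OF assms] modulus_upper[of _ z] by auto

text \<open>A Cauchy-Schwarz inequality, reduced to the unit circle by scaling.\<close>

lemma modulus_upper_sqrt: "a *\<^sub>R re z + b *\<^sub>R im z \<le> sqrt (a\<^sup>2 + b\<^sup>2) *\<^sub>R modulus z"
proof (cases "a\<^sup>2 + b\<^sup>2 = 0")
  case False
  define r where "r = sqrt (a\<^sup>2 + b\<^sup>2)"
  have r: "r > 0" "r\<^sup>2 = a\<^sup>2 + b\<^sup>2"
    using False by (auto simp: r_def sum_power2_gt_zero_iff)
  then have "(a / r)\<^sup>2 + (b / r)\<^sup>2 = 1"
    using False by (simp add: power_divide add_divide_distrib[symmetric])
  from scaleR_left_mono[OF modulus_upper_unit[OF this, of z], of r] r show ?thesis
    by (simp add: r_def[symmetric] scaleR_add_right)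
qed simp

text \<open>Controls an error \<open>v\<close> between 0 and \<open>e\<close> after multiplication
  by a coordinate of a unit vector, whose sign is unknown.\<close>

lemma scaleR_le_of_le_one:
  fixes v e :: "'a::ordered_real_vector"
  assumes "\<bar>a\<bar> \<le> 1" "0 \<le> v" "v \<le> e"
  shows "- e \<le> a *\<^sub>R v"
proof -
  have "(- a) *\<^sub>R v \<le> 1 *\<^sub>R v" using assms by (intro scaleR_right_mono) auto
  also have "\<dots> \<le> e" using assms(3) by simp
  finally show ?thesis by (simp add: minus_le_iff)
qed

text \<open>The hypothesis bounds the modulus of \<open>R + iS\<close> by \<open>c\<close> times the
  identity, written over the whole unit circle so that it survives rotation.\<close>

lemma regop_re_part_le:
  fixes R S :: "'a::dedekind_complete_vector_lattice regop"
  assumes T: "\<And>a b. a\<^sup>2 + b\<^sup>2 = 1 \<Longrightarrow> a *\<^sub>R R + b *\<^sub>R S \<le> c *\<^sub>R id_regop"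
    and c: "0 \<le> c" and e: "0 < e"
  shows "regop_apply R (re z) - regop_apply S (im z) \<le> (c + e) *\<^sub>R modulus z"
proof (rule ccontr)
  define w where "w = regop_apply R (re z) - regop_apply S (im z) - (c + e) *\<^sub>R modulus z"
  assume "\<not> ?thesis"
  then have w: "\<not> w \<le> 0" by (simp add: w_def)
  have c1: "c *\<^sub>R id_regop \<le> (c + 1) *\<^sub>R (id_regop :: 'a regop)"
    by (intro scaleR_right_mono id_regop_nonneg) simp
  have R: "central_regop R" and S: "central_regop S"
    unfolding central_regop_def
    using T[of 1 0] T[of "-1" 0] T[of 0 1] T[of 0 "-1"] c c1
    by (auto intro!: exI[of _ "c + 1"] intro: order_trans)
  \<comment> \<open>Four errors \<open>d\<close> are to fit into \<open>e\<close>: two in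
    \<open>r \<le> c + 2 * d\<close>, and one each from replacing \<open>R\<close> and
    \<open>S\<close> by scalars.\<close>
  define d where "d = e / 4"
  have d: "0 < d" "0 \<le> d" "e = 4 * d" using e by (auto simp: d_def)
  obtain H1 l where H1: "central_positive H1" "\<not> H1 w \<le> 0"
    "nonneg_on_carrier H1 (R - l *\<^sub>R id_regop)"
    "nonneg_on_carrier H1 ((l + d) *\<^sub>R id_regop - R)" using localise[OF R w d(1)] .
  \<comment> \<open>Starting from \<open>H1 w\<close> instead of \<open>w\<close> lets the product
    of both localisations keep the witness.\<close>
  obtain H2 s where H2: "central_positive H2" "\<not> H2 (H1 w) \<le> 0"
    "nonneg_on_carrier H2 (S - s *\<^sub>R id_regop)"
    "nonneg_on_carrier H2 ((s + d) *\<^sub>R id_regop - S)" using localise[OF S H1(2) d(1)] .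
  define H where "H x = H2 (H1 x)" for x
  have pos2: "positive_operator H2" using H2 by (simp add: central_positive_def)
  have H: "positive_operator H" "linear H"
    using central_positive_comp[OF H2(1) H1(1)]
    by (auto simp: H_def[abs_def] central_positive_def positive_operator_def)
  have HR: "nonneg_on_carrier H (R - l *\<^sub>R id_regop)"
    "nonneg_on_carrier H ((l + d) *\<^sub>R id_regop - R)"
    and HS: "nonneg_on_carrier H (S - s *\<^sub>R id_regop)"
    "nonneg_on_carrier H ((s + d) *\<^sub>R id_regop - S)"
    unfolding H_def[abs_def] using H1 H2 pos2
    by (auto intro: nonneg_on_carrier_comp_left nonneg_on_carrier_comp_right)
  define r where "r = sqrt (l\<^sup>2 + s\<^sup>2)"
  define m where "m = modulus z"
  have m: "0 \<le> m" "re z \<le> m" "- im z \<le> m" by (simp_all add: m_def modulus_nonneg modulus_ge)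
  have Hm: "0 \<le> H m" using H m by (simp add: positive_operator_def)
  have "r \<le> c + 2 * d"
  proof (cases "r = 0")
    case False
    then have "l\<^sup>2 + s\<^sup>2 \<noteq> 0" by (auto simp: r_def)
    then have r: "r > 0" "r\<^sup>2 = l\<^sup>2 + s\<^sup>2"
      by (auto simp: r_def sum_power2_gt_zero_iff)
    \<comment> \<open>The unit vector in the direction of \<open>(l, s)\<close>, for which the
      scalar value \<open>a * l + b * s\<close> is all of \<open>r\<close>.\<close>
    define a b where "a = l / r" and "b = s / r"
    have ab: "a\<^sup>2 + b\<^sup>2 = 1"
      using r(1) by (simp add: a_def b_def power_divide add_divide_distrib[symmetric] flip: r(2))
    have "a\<^sup>2 \<le> 1" "b\<^sup>2 \<le> 1" using ab by (metis le_add_same_cancel1 le_add_same_cancel2 zero_le_power2)+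
    then have ab1: "\<bar>a\<bar> \<le> 1" "\<bar>b\<bar> \<le> 1" by (simp_all add: abs_square_le_1)
    have "a * l + b * s = (l\<^sup>2 + s\<^sup>2) / r"
      by (simp add: a_def b_def power2_eq_square add_divide_distrib)
    also have "\<dots> = r" using r(1) by (simp only: r(2)[symmetric]) (simp add: power2_eq_square)
    finally have abr: "a * l + b * s = r" .
    \<comment> \<open>The test vector: it dominates \<open>H w\<close>, which is not nonpositive, so
      it is nonzero.\<close>
    define u where "u = H (pprt w)"
    have u0: "0 \<le> u" using H by (simp add: u_def positive_operator_def)
    have "H w \<le> u" unfolding u_def by (intro positive_operator_mono[OF H(1)]) (simp add: pprt_def)
    then have u: "u \<noteq> 0" using H2(2) by (auto simp: H_def)
    have pw: "0 \<le> pprt w" by simp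
    \<comment> \<open>\<open>f\<close> and \<open>g\<close> measure how far \<open>R\<close> and
      \<open>S\<close> are from \<open>l\<close> and \<open>s\<close>; both lie between 0 and
      \<open>d *\<^sub>R u\<close>.\<close>
    define f where "f = H (regop_apply R (pprt w)) - l *\<^sub>R u"
    define g where "g = H (regop_apply S (pprt w)) - s *\<^sub>R u"
    have f: "- (d *\<^sub>R u) \<le> a *\<^sub>R f" unfolding f_def
      using ab1(1) localised_bounds[OF H(1) HR pw] unfolding u_def by (rule scaleR_le_of_le_one)
    have g: "- (d *\<^sub>R u) \<le> b *\<^sub>R g" unfolding g_def
      using ab1(2) localised_bounds[OF H(1) HS pw] unfolding u_def by (rule scaleR_le_of_le_one)
    have "H (regop_apply (a *\<^sub>R R + b *\<^sub>R S) (pprt w)) \<le> H (regop_apply (c *\<^sub>R id_regop) (pprt w))"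
      by (intro positive_operator_mono[OF H(1)] regop_apply_mono T ab pw)
    then have "a *\<^sub>R (f + l *\<^sub>R u) + b *\<^sub>R (g + s *\<^sub>R u) \<le> c *\<^sub>R u"
      by (simp add: plus_regop.rep_eq scaleR_regop.rep_eq id_regop.rep_eq linear_add[OF H(2)]
          linear_scale[OF H(2)] u_def f_def g_def)
    moreover have "a *\<^sub>R (f + l *\<^sub>R u) + b *\<^sub>R (g + s *\<^sub>R u) = r *\<^sub>R u + (a *\<^sub>R f + b *\<^sub>R g)"
      by (simp add: abr[symmetric] algebra_simps)
    moreover have "- (d *\<^sub>R u) + - (d *\<^sub>R u) \<le> a *\<^sub>R f + b *\<^sub>R g" using f g by (rule add_mono)
    ultimately have "r *\<^sub>R u + (- (d *\<^sub>R u) + - (d *\<^sub>R u)) \<le> c *\<^sub>R u"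
      by (metis add_left_mono order_trans)
    then have le: "(r - 2 * d - c) *\<^sub>R u \<le> 0"
      by (simp add: algebra_simps flip: scaleR_2)
    show ?thesis
    proof (rule ccontr)
      assume "\<not> ?thesis"
      then have p: "0 < r - 2 * d - c" by simp
      from scaleR_left_mono[OF le, of "inverse (r - 2 * d - c)"] p have "u \<le> 0" by simp
      with u0 u show False by simp
    qed
  qed (use c d in simp)
  \<comment> \<open>The minus sign is moved into \<open>- im z\<close>, so that both errors need
    only upper bounds. The scalar part is at most \<open>r\<close> times the modulus of
    \<open>z\<close>.\<close>
  have "H w = (H (regop_apply R (re z)) - l *\<^sub>R H (re z)) +
      (H (regop_apply S (- im z)) - s *\<^sub>R H (- im z)) +
      H (l *\<^sub>R re z + (- s) *\<^sub>R im z) - (c + e) *\<^sub>R H m"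
    by (simp add: w_def m_def linear_add[OF H(2)] linear_diff[OF H(2)] linear_scale[OF H(2)]
        linear_neg[OF H(2)] linear_neg[OF regop_linear])
  also have "\<dots> \<le> d *\<^sub>R H m + d *\<^sub>R H m + r *\<^sub>R H m - (c + e) *\<^sub>R H m"
  proof (intro diff_right_mono add_mono)
    show "H (regop_apply R (re z)) - l *\<^sub>R H (re z) \<le> d *\<^sub>R H m"
      by (rule localised_bound_diff[OF H(1) HR m(2,1) d(2)])
    show "H (regop_apply S (- im z)) - s *\<^sub>R H (- im z) \<le> d *\<^sub>R H m"
      by (rule localised_bound_diff[OF H(1) HS m(3,1) d(2)])
    have "H (l *\<^sub>R re z + (- s) *\<^sub>R im z) \<le> H (r *\<^sub>R m)"
      using modulus_upper_sqrt[of l z "- s"]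
      by (intro positive_operator_mono[OF H(1)]) (simp_all add: r_def m_def)
    then show "H (l *\<^sub>R re z + (- s) *\<^sub>R im z) \<le> r *\<^sub>R H m" by (simp add: linear_scale[OF H(2)])
  qed
  also have "\<dots> = (r + 2 * d - (c + e)) *\<^sub>R H m" by (simp add: algebra_simps flip: scaleR_2)
  also have "\<dots> \<le> 0 *\<^sub>R H m"
    using \<open>r \<le> c + 2 * d\<close> d Hm by (intro scaleR_right_mono) auto
  finally show False using H2(2) by (simp add: H_def)
qed

text \<open>Each member of the supremum is the real part of a rotated image, so the previous bound
  applies. The slack \<open>e\<close> disappears only when passing to norms.\<close>

lemma modulus_cx_apply_le:
  fixes T :: "'a::dedekind_complete_vector_lattice regop complexification"
  assumes T: "modulus T \<le> c *\<^sub>R id_regop" and c: "0 \<le> c" and e: "0 < e"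
  shows "modulus (cx_apply T z) \<le> (c + e) *\<^sub>R modulus z"
proof (rule modulus_least)
  fix t :: real
  \<comment> \<open>\<open>R + iS\<close> is \<open>T\<close> multiplied by exp(-it).\<close>
  define R S where "R = cos t *\<^sub>R re T + sin t *\<^sub>R im T" and "S = cos t *\<^sub>R im T - sin t *\<^sub>R re T"
  have "a *\<^sub>R R + b *\<^sub>R S \<le> c *\<^sub>R id_regop" if "a\<^sup>2 + b\<^sup>2 = 1" for a b
  proof -
    have "(a * cos t - b * sin t)\<^sup>2 + (a * sin t + b * cos t)\<^sup>2
        = (a\<^sup>2 + b\<^sup>2) * ((cos t)\<^sup>2 + (sin t)\<^sup>2)" by algebra
    then have "(a * cos t - b * sin t)\<^sup>2 + (a * sin t + b * cos t)\<^sup>2 = 1" using that by simp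
    from order_trans[OF modulus_upper_unit[OF this, of T] T] show ?thesis
      by (simp add: R_def S_def algebra_simps)
  qed
  from regop_re_part_le[OF this c e, of z]
  show "cos t *\<^sub>R re (cx_apply T z) + sin t *\<^sub>R im (cx_apply T z) \<le> (c + e) *\<^sub>R modulus z"
    by (simp add: R_def S_def cx_apply_def minus_regop_apply plus_regop.rep_eq
        scaleR_regop.rep_eq algebra_simps)
qed

lemma modulus_Cx_nonneg:
  assumes "0 \<le> x"
  shows "modulus (Cx x 0) = x"
proof (rule antisym)
  show "modulus (Cx x 0) \<le> x"
  proof (rule modulus_least)
    fix t :: real
    have "cos t *\<^sub>R x \<le> 1 *\<^sub>R x" using assms by (intro scaleR_right_mono) auto
    then show "cos t *\<^sub>R re (Cx x 0) + sin t *\<^sub>R im (Cx x 0) \<le> x" by simp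
  qed
  show "x \<le> modulus (Cx x 0)" using modulus_ge(1)[of "Cx x 0"] by simp
qed


section \<open>The three norms\<close>

text \<open>Supplies the lower bound for both operator norms: an angle and a vector on which one
  real component of \<open>T\<close> acts at least like \<open>c\<close>.\<close>

lemma centre_not_le_witness:
  fixes T :: "'a::dedekind_complete_vector_lattice regop complexification"
  assumes "T \<in> centre" and c: "\<not> modulus T \<le> c *\<^sub>R id_regop"
  obtains t y where "t \<in> {0..2 * pi}" "0 \<le> y" "y \<noteq> 0"
    "c *\<^sub>R y \<le> regop_apply (cos t *\<^sub>R re T + sin t *\<^sub>R im T) y"
proof -
  obtain k where k: "0 \<le> k" "modulus T \<le> k *\<^sub>R id_regop" using assms by (auto simp: centre_def)
  \<comment> \<open>If every angle obeyed the bound, so would the supremum.\<close>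
  obtain t where t: "t \<in> {0..2 * pi}"
      and not_le: "\<not> cos t *\<^sub>R re T + sin t *\<^sub>R im T \<le> c *\<^sub>R id_regop"
    using c modulus_least by blast
  define A where "A = cos t *\<^sub>R re T + sin t *\<^sub>R im T"
  have "modulus T \<le> (k + 1) *\<^sub>R id_regop"
    by (rule order_trans[OF k(2)], intro scaleR_right_mono id_regop_nonneg) simp
  moreover have "A \<le> modulus T" "- A \<le> modulus T"
    using modulus_upper_unit[of "cos t" "sin t" T] modulus_upper_unit[of "- cos t" "- sin t" T]
    by (simp_all add: A_def)
  ultimately have A: "central_regop A" unfolding central_regop_def
    using k(1) by (intro exI[of _ "k + 1"]) auto
  define D where "D = A - c *\<^sub>R id_regop"
  have D: "central_regop D" unfolding D_def by (rule central_regop_shift[OF A])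
  have "\<not> D \<le> 0" using not_le by (simp add: D_def A_def)
  then have "pprt D \<noteq> 0" by (metis pprt_def sup.cobounded1)
  then obtain x where x: "0 \<le> x" "regop_apply (pprt D) x \<noteq> 0"
    using regop_eqI[of "pprt D" 0] by (auto simp: zero_regop.rep_eq)
  \<comment> \<open>The range of \<open>pprt D\<close> is annihilated by \<open>pprt (- D)\<close>,
    so \<open>D\<close> acts on \<open>y\<close> as its positive part.\<close>
  define y where "y = regop_apply (pprt D) x"
  have y: "0 \<le> y" using positive_operator_pprt[of D] x by (simp add: y_def positive_operator_def)
  have "regop_apply (pprt (- D)) y = 0"
    using central_regop_parts_comp[OF central_regop_minus[OF D] x(1)] by (simp add: y_def)
  then have "regop_apply D y = regop_apply (pprt D) y" by (simp add: regop_apply_pprt_diff[of D])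
  also have "\<dots> \<ge> 0" using positive_operator_pprt[of D] y by (simp add: positive_operator_def)
  finally have "c *\<^sub>R y \<le> regop_apply A y"
    by (simp add: D_def minus_regop_apply scaleR_regop.rep_eq id_regop.rep_eq)
  then show ?thesis using that t y x(2) by (simp add: A_def y_def)
qed

section \<open>Comparison of operator norms with the order unit norm\<close>

lemma norm_mono_nonneg:
  fixes x y :: "'a::dedekind_complete_banach_lattice"
  assumes "0 \<le> x" "x \<le> y"
  shows "norm x \<le> norm y"
  using assms by (intro norm_mono_abs) (simp add: abs_of_nonneg order_trans[OF assms])

text \<open>The absolute value of \<open>P x\<close> is at most \<open>P \<bar>x\<bar>\<close>,
  hence at most \<open>c *\<^sub>R \<bar>x\<bar>\<close>, and the norm is monotone.\<close>

lemma norm_positive_operator_le: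
  fixes P :: "'a::dedekind_complete_banach_lattice \<Rightarrow> 'a"
  assumes P: "positive_operator P" and c: "0 \<le> c" "\<And>x. 0 \<le> x \<Longrightarrow> P x \<le> c *\<^sub>R x"
  shows "norm (P x) \<le> c * norm x"
proof -
  have lin: "linear P" using P by (simp add: positive_operator_def)
  have "P x \<le> P \<bar>x\<bar>" "P (- x) \<le> P \<bar>x\<bar>"
    by (intro positive_operator_mono[OF P]; simp add: abs_ge_self abs_ge_minus_self)+
  moreover have "P \<bar>x\<bar> \<le> c *\<^sub>R \<bar>x\<bar>" by (simp add: c)
  ultimately have "\<bar>P x\<bar> \<le> c *\<^sub>R \<bar>x\<bar>"
    by (intro abs_leI) (auto simp: linear_neg[OF lin] intro: order_trans)
  also have "\<dots> = \<bar>c *\<^sub>R \<bar>x\<bar>\<bar>" using c(1) by (simp add: scaleR_nonneg_nonneg)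
  finally have "norm (P x) \<le> norm (c *\<^sub>R \<bar>x\<bar>)" by (rule norm_mono_abs)
  also have "\<dots> \<le> c * norm x" using c norm_mono_abs[of "\<bar>x\<bar>" x] by (simp add: mult_left_mono)
  finally show ?thesis .
qed

lemma linear_cx_apply: "linear (cx_apply T)"
  for T :: "'a::dedekind_complete_vector_lattice regop complexification"
  by (rule linearI)
     (auto simp: cx_apply_def plus_complexification_def scaleR_complexification_def algebra_simps
        linear_add[OF regop_linear] linear_scale[OF regop_linear])

text \<open>A nonnegative \<open>c\<close> below the infimum is not admissible, so its witness
  forces \<open>onorm f\<close> up to \<open>c\<close>. A general \<open>f\<close> covers both the
  modulus on the real space and \<open>T\<close> on its complexification.\<close>

lemma order_unit_norm_le_onorm:
  fixes T :: "'a::dedekind_complete_banach_lattice regop complexification"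
    and f :: "'b::real_normed_vector \<Rightarrow> 'c::real_normed_vector"
  assumes f: "bounded_linear f"
    and wit: "\<And>c. 0 \<le> c \<Longrightarrow> \<not> modulus T \<le> c *\<^sub>R id_regop \<Longrightarrow> \<exists>x. x \<noteq> 0 \<and> c * norm x \<le> norm (f x)"
  shows "order_unit_norm T \<le> onorm f"
proof (rule dense_le)
  fix c assume c: "c < order_unit_norm T"
  show "c \<le> onorm f"
  proof (cases "0 \<le> c")
    case True
    have "\<not> modulus T \<le> c *\<^sub>R id_regop"
      using c True cInf_lower[of c "{c. 0 \<le> c \<and> modulus T \<le> c *\<^sub>R id_regop}"]
      by (force simp: order_unit_norm_def intro: bdd_belowI[of _ 0])
    from wit[OF True this] obtain x where x: "x \<noteq> 0" "c * norm x \<le> norm (f x)" by blast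
    with onorm[OF f, of x] have "c * norm x \<le> onorm f * norm x" by linarith
    with x(1) show ?thesis by (simp add: mult_le_cancel_right)
  next
    case False
    with onorm_pos_le[OF f] show ?thesis by simp
  qed
qed

text \<open>Each \<open>b\<close> above the infimum exceeds an admissible \<open>c\<close>, and the
  slack \<open>b - c\<close> turns the bound into exactly \<open>b\<close>.\<close>

lemma onorm_le_order_unit_norm:
  fixes T :: "'a::dedekind_complete_banach_lattice regop complexification"
    and f :: "'b::real_normed_vector \<Rightarrow> 'c::real_normed_vector"
  assumes T: "T \<in> centre"
    and bound: "\<And>c e x. 0 \<le> c \<Longrightarrow> modulus T \<le> c *\<^sub>R id_regop \<Longrightarrow> 0 < e \<Longrightarrow> norm (f x) \<le> (c + e) * norm x"
  shows "onorm f \<le> order_unit_norm T"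
proof (rule dense_ge)
  fix b assume b: "order_unit_norm T < b"
  have "{c. 0 \<le> c \<and> modulus T \<le> c *\<^sub>R id_regop} \<noteq> {}" using T by (auto simp: centre_def)
  from cInf_lessD[OF this] b obtain c where c: "0 \<le> c" "modulus T \<le> c *\<^sub>R id_regop" "c < b"
    by (auto simp: order_unit_norm_def)
  from bound[OF c(1,2), of "b - c"] c show "onorm f \<le> b"
    by (intro onorm_bound) auto
qed

theorem corollary3p3:
  fixes T :: "'a::dedekind_complete_banach_lattice regop complexification"
  assumes "T \<in> centre"
  shows "order_unit_norm T = regular_norm T \<and> regular_norm T = onorm (cx_apply T)"
proof -
  define M where "M = regop_apply (modulus T)"
  have M: "positive_operator M" using modulus_nonneg[of T] unfolding M_def
    by (auto simp: positive_operator_def regop_linear less_eq_regop_def zero_regop.rep_eq)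
  have M_bound: "norm (M x) \<le> (c + e) * norm x"
    if "0 \<le> c" "modulus T \<le> c *\<^sub>R id_regop" "0 < e" for c e x
  proof -
    have "M x \<le> c *\<^sub>R x" if "0 \<le> x" for x
      using regop_apply_mono[OF \<open>modulus T \<le> _\<close> that]
      by (simp add: M_def scaleR_regop.rep_eq id_regop.rep_eq)
    from norm_positive_operator_le[OF M that(1) this]
    have "norm (M x) \<le> c * norm x" .
    also have "\<dots> \<le> (c + e) * norm x" using that by (intro mult_right_mono) auto
    finally show ?thesis .
  qed
  have T_bound: "norm (cx_apply T z) \<le> (c + e) * norm z"
    if "0 \<le> c" "modulus T \<le> c *\<^sub>R id_regop" "0 < e" for c e z
  proof -
    have "norm (modulus (cx_apply T z)) \<le> norm ((c + e) *\<^sub>R modulus z)"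
      by (intro norm_mono_nonneg modulus_nonneg modulus_cx_apply_le that)
    then show ?thesis using that by (simp add: norm_complexification_def)
  qed
  obtain k where k: "0 \<le> k" "modulus T \<le> k *\<^sub>R id_regop" using assms by (auto simp: centre_def)
  have bl: "bounded_linear M" "bounded_linear (cx_apply T)"
    using M_bound[OF k, of 1] T_bound[OF k, of 1] M linear_cx_apply[of T]
    by (auto simp: positive_operator_def bounded_linear_def bounded_linear_axioms_def mult.commute
        intro!: exI[of _ "k + 1"])
  \<comment> \<open>One \<open>y\<close> serves both operators: \<open>M y\<close> dominates the
    component of angle \<open>t\<close> applied to \<open>y\<close>, and so does the modulus of the
    image of \<open>Cx y 0\<close>.\<close>
  have wit: "(\<exists>x. x \<noteq> 0 \<and> c * norm x \<le> norm (M x)) \<and>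
      (\<exists>z. z \<noteq> 0 \<and> c * norm z \<le> norm (cx_apply T z))"
    if c: "0 \<le> c" "\<not> modulus T \<le> c *\<^sub>R id_regop" for c
  proof -
    obtain t y where t: "t \<in> {0..2 * pi}" and y: "0 \<le> y" "y \<noteq> 0"
      "c *\<^sub>R y \<le> regop_apply (cos t *\<^sub>R re T + sin t *\<^sub>R im T) y"
      by (rule centre_not_le_witness[OF assms c(2)])
    have cy: "0 \<le> c *\<^sub>R y" using c y by (simp add: scaleR_nonneg_nonneg)
    have "c *\<^sub>R y \<le> M y"
      using y(3) regop_apply_mono[OF modulus_upper[OF t] y(1), of T] by (simp add: M_def)
    from norm_mono_nonneg[OF cy this] have "c * norm y \<le> norm (M y)" using c by simp
    moreover have "c *\<^sub>R y \<le> modulus (cx_apply T (Cx y 0))"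
      using y(3) modulus_upper[OF t, of "cx_apply T (Cx y 0)"]
      by (simp add: cx_apply_def plus_regop.rep_eq scaleR_regop.rep_eq linear_0[OF regop_linear])
    from norm_mono_nonneg[OF cy this]
    have "c * norm (Cx y 0) \<le> norm (cx_apply T (Cx y 0))"
      using c y by (simp add: norm_complexification_def modulus_Cx_nonneg)
    moreover have "Cx y 0 \<noteq> 0" using y by (simp add: zero_complexification_def)
    ultimately show ?thesis using y(2) by blast
  qed
  have "order_unit_norm T = onorm M"
    using order_unit_norm_le_onorm[OF bl(1) wit[THEN conjunct1]]
      onorm_le_order_unit_norm[OF assms M_bound] by (rule antisym)
  moreover have "order_unit_norm T = onorm (cx_apply T)"
    using order_unit_norm_le_onorm[OF bl(2) wit[THEN conjunct2]]
      onorm_le_order_unit_norm[OF assms T_bound] by (rule antisym)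
  ultimately show ?thesis by (simp add: regular_norm_def M_def)
qed

end
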